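(* Let $\Omega\subset\mathbb{R}^d$ be compact and convex with non-negligible interior, let $\mu,\nu\in\mathcal{P}(\Omega)$ with $\mu\ll\mathcal{L}_d$, and let $\lambda>0$. Then the minimal value of $$\inf_{\rho\in\mathcal{P}(\Omega)}\ \frac12W_2^2(\mu,\rho)+\lambda W_1(\rho,\nu)$$ is equal to $$\mathcal{I}_{c_{2,\lambda}}(\mu,\nu)=\inf\Big\{\int_{\Omega\times\Omega}c_{2,\lambda}(x,y)\,d\gamma\ \Big|\ \gamma\in\Pi(\mu,\nu)\Big\}.$$
   Context: $\mathcal{P}(\Omega)$ is the set of Borel probability measures on $\Omega$, $\mathcal{L}_d$ is Lebesgue measure, $W_p$ is the Wasserstein $p$ distance for the Euclidean distance, and $\Pi(\mu,\nu)$ is the set of probability measures on $\Omega\times\Omega$ with marginals $\mu$ and $\nu$. The Huber cost is $c_{2,\lambda}(x,y)=\frac12|x-y|^2$ if $|x-y|\le\lambda$ and $c_{2,\lambda}(x,y)=\lambda|x-y|-\frac{\lambda^2}{2}$ if $|x-y|\ge\lambda$. *)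

theory Defs
  imports "HOL-Probability.Probability"
begin

definition prob_measures_on :: "'a::topological_space set \<Rightarrow> 'a measure set" where
  "prob_measures_on \<Omega> = {\<mu>. prob_space \<mu> \<and> sets \<mu> = sets (restrict_space borel \<Omega>)}"

definition couplings :: "'a measure \<Rightarrow> 'b measure \<Rightarrow> ('a \<times> 'b) measure set" where
  "couplings \<mu> \<nu> =
    {\<gamma>. prob_space \<gamma> \<and> sets \<gamma> = sets (\<mu> \<Otimes>\<^sub>M \<nu>) \<and> distr \<gamma> \<mu> fst = \<mu> \<and> distr \<gamma> \<nu> snd = \<nu>}"

text \<open>
  The integral and the infimum are real-valued. They are meaningful for nonnegative continuous
  costs and probability measures on a compact set: every coupling then integrates the cost, and
  there is at least one coupling (the two lemmas below).
\<close>

definition transport_cost :: "('a \<Rightarrow> 'b \<Rightarrow> real) \<Rightarrow> 'a measure \<Rightarrow> 'b measure \<Rightarrow> real" where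
  "transport_cost c \<mu> \<nu> = (INF \<gamma>\<in>couplings \<mu> \<nu>. \<integral>(x, y). c x y \<partial>\<gamma>)"

definition wasserstein :: "real \<Rightarrow> 'a::metric_space measure \<Rightarrow> 'a measure \<Rightarrow> real" where
  "wasserstein p \<mu> \<nu> = transport_cost (\<lambda>x y. dist x y powr p) \<mu> \<nu> powr (1 / p)"

definition huber_cost :: "real \<Rightarrow> 'a::metric_space \<Rightarrow> 'a \<Rightarrow> real" where
  "huber_cost lam x y =
    (if dist x y \<le> lam then 1 / 2 * (dist x y)\<^sup>2 else lam * dist x y - lam\<^sup>2 / 2)"

lemma pair_measure_in_couplings:
  assumes "prob_space \<mu>" and "prob_space \<nu>"
  shows "\<mu> \<Otimes>\<^sub>M \<nu> \<in> couplings \<mu> \<nu>"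
proof -
  interpret \<mu>: prob_space \<mu> by fact
  interpret \<nu>: prob_space \<nu> by fact
  interpret pair_prob_space \<mu> \<nu> ..
  have "distr (\<mu> \<Otimes>\<^sub>M \<nu>) \<nu> snd = \<nu>"
  proof (rule measure_eqI)
    fix A assume "A \<in> sets (distr (\<mu> \<Otimes>\<^sub>M \<nu>) \<nu> snd)"
    then have A: "A \<in> sets \<nu>" by simp
    have "snd -` A \<inter> space (\<mu> \<Otimes>\<^sub>M \<nu>) = space \<mu> \<times> A"
      using sets.sets_into_space[OF A] by (auto simp: space_pair_measure)
    with A show "emeasure (distr (\<mu> \<Otimes>\<^sub>M \<nu>) \<nu> snd) A = emeasure \<nu> A"
      by (simp add: emeasure_distr \<nu>.emeasure_pair_measure_Times \<mu>.emeasure_space_1)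
  qed simp
  then show ?thesis
    unfolding couplings_def
    using \<nu>.distr_pair_fst[of \<mu>] prob_space_axioms by simp
qed

lemma integrable_coupling:
  fixes \<Omega> :: "'a::{second_countable_topology, metric_space} set"
  assumes "compact \<Omega>" and "\<mu> \<in> prob_measures_on \<Omega>" and "\<nu> \<in> prob_measures_on \<Omega>"
    and "\<gamma> \<in> couplings \<mu> \<nu>" and c: "continuous_on (\<Omega> \<times> \<Omega>) (\<lambda>(x, y). c x y :: real)"
  shows "integrable \<gamma> (\<lambda>(x, y). c x y)"
proof -
  interpret prob_space \<gamma> using assms(4) by (simp add: couplings_def)
  have \<mu>: "sets \<mu> = sets (restrict_space borel \<Omega>)" and \<nu>: "sets \<nu> = sets (restrict_space borel \<Omega>)"
    and \<gamma>: "sets \<gamma> = sets (\<mu> \<Otimes>\<^sub>M \<nu>)"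
    using assms(2-4) by (auto simp: couplings_def prob_measures_on_def)
  have sp: "space \<gamma> = \<Omega> \<times> \<Omega>"
    using sets_eq_imp_space_eq[OF \<mu>] sets_eq_imp_space_eq[OF \<nu>] sets_eq_imp_space_eq[OF \<gamma>]
    by (simp add: space_restrict_space space_pair_measure)
  have id: "(\<lambda>x. x) \<in> restrict_space borel \<Omega> \<rightarrow>\<^sub>M borel"
    by (simp add: measurable_restrict_space1)
  have id\<mu>: "(\<lambda>x. x) \<in> \<mu> \<rightarrow>\<^sub>M borel" and id\<nu>: "(\<lambda>x. x) \<in> \<nu> \<rightarrow>\<^sub>M borel"
    using id measurable_cong_sets[OF \<mu> refl] measurable_cong_sets[OF \<nu> refl] by blast+
  have "(\<lambda>z. (fst z, snd z)) \<in> \<mu> \<Otimes>\<^sub>M \<nu> \<rightarrow>\<^sub>M borel \<Otimes>\<^sub>M borel"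
    using measurable_compose[OF measurable_fst id\<mu>] measurable_compose[OF measurable_snd id\<nu>]
    by (intro measurable_Pair) auto
  then have "(\<lambda>z. z) \<in> \<gamma> \<rightarrow>\<^sub>M borel"
    using measurable_cong_sets[OF \<gamma> refl] by (auto simp: borel_prod)
  then have "(\<lambda>z. z) \<in> \<gamma> \<rightarrow>\<^sub>M restrict_space borel (\<Omega> \<times> \<Omega>)"
    by (intro measurable_restrict_space2) (auto simp: sp)
  from measurable_compose[OF this borel_measurable_continuous_on_restrict[OF c]]
  have m: "(\<lambda>(x, y). c x y) \<in> borel_measurable \<gamma>" .
  have "bounded ((\<lambda>(x, y). c x y) ` (\<Omega> \<times> \<Omega>))"
    using assms(1) c by (intro compact_imp_bounded compact_continuous_image compact_Times)
  then obtain B where "\<forall>z\<in>\<Omega> \<times> \<Omega>. norm (case z of (x, y) \<Rightarrow> c x y) \<le> B"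
    unfolding bounded_iff by auto
  with m show ?thesis
    by (intro integrable_const_bound[of _ B]) (auto simp: sp)
qed

end

theory Submission imports Defs
begin

text \<open>
  Both inequalities compare pairs of plans, one from \<open>\<mu>\<close> to \<open>\<rho>\<close> and one from \<open>\<rho>\<close> to \<open>\<nu>\<close>, with
  single plans from \<open>\<mu>\<close> to \<open>\<nu>\<close>.
  They rest on the fact that the Huber cost is the infimal convolution of the two costs: on every
  path \<open>x, z, y\<close> one has \<open>huber_cost lam x y \<le> \<bar>x - z\<bar>\<^sup>2 / 2 + lam * \<bar>z - y\<bar>\<close>
  (\<open>huber_cost_le_detour\<close>), with equality at the point \<open>z\<close> of the segment from \<open>x\<close> to \<open>y\<close> at distance
  \<open>min lam \<bar>x - y\<bar>\<close> from \<open>x\<close> (\<open>huber_cost_eq_split\<close>).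

  The infimum over \<open>\<rho>\<close> is at most the Huber transport cost: given a plan from \<open>\<mu>\<close> to \<open>\<nu>\<close>, let
  \<open>\<rho>\<close> be the law of the optimal intermediate point \<open>z\<close>, which lies in \<open>\<Omega>\<close> by convexity. The laws of
  \<open>(x, z)\<close> and \<open>(z, y)\<close> are plans whose costs add up to the Huber cost of the given plan.

  Conversely, a plan from \<open>\<mu>\<close> to \<open>\<rho>\<close> and a plan from \<open>\<rho>\<close> to \<open>\<nu>\<close> have to be composed. For
  an inequality between infima it is enough to do this approximately, without disintegrating the
  plans along \<open>\<rho>\<close>: cut the space into countably many Borel cells whose
  points are less than \<open>\<epsilon>\<close> apart and, conditionally on the cell of the intermediate point, let
  the two plans be independent. The resulting joint law has both plans as
  exact marginals, while its two intermediate points are only \<open>\<epsilon>\<close>-close (\<open>approximate_gluing\<close>). The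
  cost with slope \<open>lam\<close> pays at most \<open>lam * \<epsilon>\<close> for this gap, and \<open>\<epsilon>\<close> tends to \<open>0\<close>.
\<close>

section \<open>Couplings\<close>

lemma couplingD:
  assumes "\<gamma> \<in> couplings \<mu> \<nu>"
  shows "prob_space \<gamma>" "sets \<gamma> = sets (\<mu> \<Otimes>\<^sub>M \<nu>)" "fst \<in> \<gamma> \<rightarrow>\<^sub>M \<mu>" "snd \<in> \<gamma> \<rightarrow>\<^sub>M \<nu>"
    "distr \<gamma> \<mu> fst = \<mu>" "distr \<gamma> \<nu> snd = \<nu>"
proof -
  show s: "sets \<gamma> = sets (\<mu> \<Otimes>\<^sub>M \<nu>)"
    using assms by (simp add: couplings_def)
  show "fst \<in> \<gamma> \<rightarrow>\<^sub>M \<mu>" "snd \<in> \<gamma> \<rightarrow>\<^sub>M \<nu>"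
    by (simp_all add: measurable_cong_sets[OF s refl])
qed (use assms in \<open>simp_all add: couplings_def\<close>)

lemma distr_Pair_in_couplings:
  assumes "prob_space M" and f: "f \<in> M \<rightarrow>\<^sub>M \<mu>" and g: "g \<in> M \<rightarrow>\<^sub>M \<nu>"
    and "distr M \<mu> f = \<mu>" and "distr M \<nu> g = \<nu>"
  shows "distr M (\<mu> \<Otimes>\<^sub>M \<nu>) (\<lambda>w. (f w, g w)) \<in> couplings \<mu> \<nu>"
  using assms
  by (simp add: couplings_def prob_space.prob_space_distr distr_distr o_def)

lemma transport_cost_le_integral:
  assumes "\<And>x y. 0 \<le> c x y" and "\<gamma> \<in> couplings \<mu> \<nu>"
  shows "transport_cost c \<mu> \<nu> \<le> (\<integral>(x, y). c x y \<partial>\<gamma>)"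
  unfolding transport_cost_def
  using assms by (intro cINF_lower bdd_belowI2[of _ 0]) (auto intro!: integral_nonneg_AE)

lemma transport_cost_greatest:
  assumes "prob_space \<mu>" and "prob_space \<nu>"
    and "\<And>\<gamma>. \<gamma> \<in> couplings \<mu> \<nu> \<Longrightarrow> K \<le> (\<integral>(x, y). c x y \<partial>\<gamma>)"
  shows "K \<le> transport_cost c \<mu> \<nu>"
  unfolding transport_cost_def
  using assms pair_measure_in_couplings[OF assms(1,2)] by (intro cINF_greatest) auto

lemma transport_cost_nonneg:
  assumes "prob_space \<mu>" and "prob_space \<nu>" and "\<And>x y. 0 \<le> c x y"
  shows "0 \<le> transport_cost c \<mu> \<nu>"
  using assms by (intro transport_cost_greatest) (auto intro!: integral_nonneg_AE)

lemma wasserstein_1_eq: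
  assumes "prob_space \<mu>" and "prob_space \<nu>"
  shows "wasserstein 1 \<mu> \<nu> = transport_cost dist \<mu> \<nu>"
  using transport_cost_nonneg[OF assms, of dist] by (simp add: wasserstein_def)

lemma wasserstein_2_squared_eq:
  assumes "prob_space \<mu>" and "prob_space \<nu>"
  shows "(wasserstein 2 \<mu> \<nu>)\<^sup>2 = transport_cost (\<lambda>x y. (dist x y)\<^sup>2) \<mu> \<nu>"
  using transport_cost_nonneg[OF assms, of "\<lambda>x y. (dist x y)\<^sup>2"]
  by (simp add: wasserstein_def powr_half_sqrt)

section \<open>Approximate gluing of plans\<close>

text \<open>
  The coupling below has density \<open>1 / R {i}\<close> where both labels equal \<open>i\<close>. This density
  integrates to \<open>1\<close> in either variable, which is what makes the marginals exact; the labels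
  of mass \<open>0\<close>, where it does not, form a countable and hence null set.
\<close>

lemma AE_same_label_density:
  fixes f :: "'a \<Rightarrow> nat" and g :: "'b \<Rightarrow> nat"
  assumes "prob_space P" and "prob_space Q"
    and f[measurable]: "f \<in> P \<rightarrow>\<^sub>M count_space UNIV" and g[measurable]: "g \<in> Q \<rightarrow>\<^sub>M count_space UNIV"
    and R: "distr P (count_space UNIV) f = R" "distr Q (count_space UNIV) g = R"
  shows "AE p in P. (\<integral>\<^sup>+q. (if f p = g q then inverse (emeasure R {f p}) else 0) \<partial>Q) = 1"
proof -
  interpret Q: prob_space Q by fact
  have "AE i in R. emeasure R {i} \<noteq> 0"
  proof -
    have "AE i in R. \<forall>j. emeasure R {j} = 0 \<longrightarrow> i \<noteq> j"
      unfolding AE_all_countable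
    proof (intro allI)
      fix j
      show "AE i in R. emeasure R {j} = 0 \<longrightarrow> i \<noteq> j"
        by (cases "emeasure R {j} = 0") (auto simp: R(1)[symmetric] intro!: AE_I[of _ _ "{j}"])
    qed
    then show ?thesis by auto
  qed
  then have "AE p in P. emeasure R {f p} \<noteq> 0"
    unfolding R(1)[symmetric] by (subst (asm) AE_distr_iff) auto
  then show ?thesis
  proof eventually_elim
    case (elim p)
    have "(\<integral>\<^sup>+q. (if f p = g q then inverse (emeasure R {f p}) else 0) \<partial>Q)
        = (\<integral>\<^sup>+q. inverse (emeasure R {f p}) * indicator (g -` {f p} \<inter> space Q) q \<partial>Q)"
      by (intro nn_integral_cong) (auto simp: indicator_def)
    also have "\<dots> = inverse (emeasure R {f p}) * emeasure Q (g -` {f p} \<inter> space Q)"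
      by (intro nn_integral_cmult_indicator) measurable
    also have "emeasure Q (g -` {f p} \<inter> space Q) = emeasure R {f p}"
      unfolding R(2)[symmetric] by (subst emeasure_distr) auto
    also have "emeasure R {f p} \<noteq> \<infinity>"
      unfolding R(2)[symmetric] by (subst emeasure_distr) auto
    then have "inverse (emeasure R {f p}) * emeasure R {f p} = 1"
      using elim by (simp add: ennreal_divide_self[unfolded divide_ennreal_def] mult.commute less_top)
    finally show ?case .
  qed
qed

text \<open>
  Take \<open>P\<close> and \<open>Q\<close> conditionally independent given the common label. With countably
  many labels, conditioning is elementary and the law is absolutely continuous with respect to the
  product measure.
\<close>

lemma coupling_with_same_label:
  fixes f :: "'a \<Rightarrow> nat" and g :: "'b \<Rightarrow> nat"
  assumes P: "prob_space P" and Q: "prob_space Q"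
    and f[measurable]: "f \<in> P \<rightarrow>\<^sub>M count_space UNIV" and g[measurable]: "g \<in> Q \<rightarrow>\<^sub>M count_space UNIV"
    and same: "distr P (count_space UNIV) f = distr Q (count_space UNIV) g"
  shows "\<exists>G\<in>couplings P Q. AE (p, q) in G. f p = g q"
proof -
  interpret P: prob_space P by fact
  interpret Q: prob_space Q by fact
  interpret pair_sigma_finite P Q ..
  define R where "R = distr Q (count_space UNIV) g"
  define h where "h p q = (if f p = g q then inverse (emeasure R {f p}) else 0)" for p q
  have h: "(\<lambda>w. h (fst w) (snd w)) \<in> borel_measurable (P \<Otimes>\<^sub>M Q)"
  proof -
    \<comment> \<open>Fixing the first label makes the density a function of the second label alone.\<close>
    define k where "k i j = (if i = j then inverse (emeasure R {i}) else 0)" for i j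
    have "(\<lambda>w. k i (g (snd w))) \<in> borel_measurable (P \<Otimes>\<^sub>M Q)" for i
      by (rule measurable_compose[OF measurable_compose[OF measurable_snd g]]) simp
    then have "(\<lambda>w. k (f (fst w)) (g (snd w))) \<in> borel_measurable (P \<Otimes>\<^sub>M Q)"
      by (rule measurable_compose_countable[where f = "\<lambda>i w. k i (g (snd w))"])
        (rule measurable_compose[OF measurable_fst f])
    then show ?thesis
      by (simp only: h_def k_def)
  qed
  define G where "G = density (P \<Otimes>\<^sub>M Q) (\<lambda>w. h (fst w) (snd w))"
  have sets_G: "sets G = sets (P \<Otimes>\<^sub>M Q)"
    by (simp add: G_def)
  have fstm: "fst \<in> G \<rightarrow>\<^sub>M P" and sndm: "snd \<in> G \<rightarrow>\<^sub>M Q"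
    by (simp_all add: G_def)
  have "AE p in P. (\<integral>\<^sup>+q. h p q \<partial>Q) = 1"
    unfolding h_def R_def by (rule AE_same_label_density[OF P Q f g same refl])
  then have fst_mass: "emeasure (distr G P fst) A = emeasure P A" if A: "A \<in> sets P" for A
  proof -
    have "emeasure (distr G P fst) A = emeasure G (fst -` A \<inter> space G)"
      by (rule emeasure_distr[OF fstm A])
    also have "\<dots> = (\<integral>\<^sup>+w. h (fst w) (snd w) * indicator (fst -` A \<inter> space (P \<Otimes>\<^sub>M Q)) w \<partial>(P \<Otimes>\<^sub>M Q))"
      unfolding G_def space_density by (rule emeasure_density[OF h measurable_sets[OF measurable_fst A]])
    also have "\<dots> = (\<integral>\<^sup>+w. h (fst w) (snd w) * indicator A (fst w) \<partial>(P \<Otimes>\<^sub>M Q))"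
      by (rule nn_integral_cong) (simp add: indicator_def)
    also have "\<dots> = (\<integral>\<^sup>+p. \<integral>\<^sup>+q. h p q * indicator A p \<partial>Q \<partial>P)"
    proof -
      have "(\<lambda>w. h (fst w) (snd w) * indicator A (fst w)) \<in> borel_measurable (P \<Otimes>\<^sub>M Q)"
        by (intro borel_measurable_times_ennreal h measurable_compose[OF measurable_fst]
            borel_measurable_indicator A)
      from Q.nn_integral_fst[OF this] show ?thesis by simp
    qed
    also have "\<dots> = (\<integral>\<^sup>+p. (\<integral>\<^sup>+q. h p q \<partial>Q) * indicator A p \<partial>P)"
      using measurable_Pair2[OF h] by (intro nn_integral_cong nn_integral_multc) simp
    also have "\<dots> = (\<integral>\<^sup>+p. indicator A p \<partial>P)"
      using \<open>AE p in P. (\<integral>\<^sup>+q. h p q \<partial>Q) = 1\<close> by (intro nn_integral_cong_AE) auto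
    finally show ?thesis using A by simp
  qed
  have h_swap: "h p q = (if g q = f p then inverse (emeasure R {g q}) else 0)" for p q
    by (simp add: h_def)
  have "AE q in Q. (\<integral>\<^sup>+p. h p q \<partial>P) = 1"
    unfolding h_swap R_def by (rule AE_same_label_density[OF Q P g f refl same])
  then have snd_mass: "emeasure (distr G Q snd) A = emeasure Q A" if A: "A \<in> sets Q" for A
  proof -
    have "emeasure (distr G Q snd) A = emeasure G (snd -` A \<inter> space G)"
      by (rule emeasure_distr[OF sndm A])
    also have "\<dots> = (\<integral>\<^sup>+w. h (fst w) (snd w) * indicator (snd -` A \<inter> space (P \<Otimes>\<^sub>M Q)) w \<partial>(P \<Otimes>\<^sub>M Q))"
      unfolding G_def space_density by (rule emeasure_density[OF h measurable_sets[OF measurable_snd A]])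
    also have "\<dots> = (\<integral>\<^sup>+w. h (fst w) (snd w) * indicator A (snd w) \<partial>(P \<Otimes>\<^sub>M Q))"
      by (rule nn_integral_cong) (simp add: indicator_def)
    also have "\<dots> = (\<integral>\<^sup>+q. \<integral>\<^sup>+p. h p q * indicator A q \<partial>P \<partial>Q)"
    proof -
      have "(\<lambda>w. h (fst w) (snd w) * indicator A (snd w)) \<in> borel_measurable (P \<Otimes>\<^sub>M Q)"
        by (intro borel_measurable_times_ennreal h measurable_compose[OF measurable_snd]
            borel_measurable_indicator A)
      from nn_integral_snd[OF this] show ?thesis by simp
    qed
    also have "\<dots> = (\<integral>\<^sup>+q. (\<integral>\<^sup>+p. h p q \<partial>P) * indicator A q \<partial>Q)"
      using measurable_Pair1[OF h] by (intro nn_integral_cong nn_integral_multc) simp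
    also have "\<dots> = (\<integral>\<^sup>+q. indicator A q \<partial>Q)"
      using \<open>AE q in Q. (\<integral>\<^sup>+p. h p q \<partial>P) = 1\<close> by (intro nn_integral_cong_AE) auto
    finally show ?thesis using A by simp
  qed
  have fst_distr: "distr G P fst = P" and snd_distr: "distr G Q snd = Q"
    using fst_mass snd_mass by (auto intro!: measure_eqI)
  have "prob_space G"
    using prob_space_distrD[OF fstm] P fst_distr by simp
  then have "G \<in> couplings P Q"
    unfolding couplings_def using fst_distr snd_distr by (simp add: sets_G)
  moreover have "AE w in G. f (fst w) = g (snd w)"
    unfolding G_def by (subst AE_density[OF h]) (simp add: h_def)
  ultimately show ?thesis
    by (auto simp: split_beta)
qed

text \<open>
  The label of a point is the index of the first member of a countable dense set within distance
  \<open>\<epsilon> / 2\<close>, so that points with equal labels are \<open>\<epsilon>\<close>-close. Both intermediate points have law \<open>\<rho>\<close>,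
  hence their labels have the same law.
\<close>

lemma approximate_gluing:
  fixes \<rho> :: "'b::{second_countable_topology, metric_space} measure" and \<epsilon> :: real
  assumes \<gamma>: "\<gamma> \<in> couplings \<mu> \<rho>" and \<gamma>': "\<gamma>' \<in> couplings \<rho> \<nu>"
    and id[measurable]: "(\<lambda>x. x) \<in> \<rho> \<rightarrow>\<^sub>M borel" and "0 < \<epsilon>"
  shows "\<exists>G\<in>couplings \<gamma> \<gamma>'. AE (p, q) in G. dist (snd p) (fst q) < \<epsilon>"
proof -
  obtain D :: "'b set" where D: "countable D" "\<And>X. open X \<Longrightarrow> X \<noteq> {} \<Longrightarrow> \<exists>d\<in>D. d \<in> X"
    using countable_dense_exists by blast
  have near: "\<exists>n. dist z (from_nat_into D n) < \<epsilon> / 2" for z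
  proof -
    obtain d where "d \<in> D" "d \<in> ball z (\<epsilon> / 2)"
      using D(2)[of "ball z (\<epsilon> / 2)"] \<open>0 < \<epsilon>\<close> by auto
    then show ?thesis
      using from_nat_into_surj[OF D(1)] by (metis mem_ball)
  qed
  define label where "label z = (LEAST n. dist z (from_nat_into D n) < \<epsilon> / 2)" for z
  have label_near: "dist z (from_nat_into D (label z)) < \<epsilon> / 2" for z
    unfolding label_def by (rule LeastI_ex[OF near])
  have close: "dist z z' < \<epsilon>" if "label z = label z'" for z z'
    using dist_triangle_half_r[of "from_nat_into D (label z)" z \<epsilon> z'] label_near[of z] label_near[of z'] that
    by (simp add: dist_commute)
  have label: "label \<in> \<rho> \<rightarrow>\<^sub>M count_space UNIV"
    unfolding label_def by measurable
  have "distr \<gamma> (count_space UNIV) (\<lambda>p. label (snd p)) = distr (distr \<gamma> \<rho> snd) (count_space UNIV) label"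
    using distr_distr[OF label couplingD(4)[OF \<gamma>]] by (simp add: o_def)
  moreover have "distr \<gamma>' (count_space UNIV) (\<lambda>q. label (fst q)) = distr (distr \<gamma>' \<rho> fst) (count_space UNIV) label"
    using distr_distr[OF label couplingD(3)[OF \<gamma>']] by (simp add: o_def)
  ultimately have "distr \<gamma> (count_space UNIV) (\<lambda>p. label (snd p)) = distr \<gamma>' (count_space UNIV) (\<lambda>q. label (fst q))"
    by (simp add: couplingD[OF \<gamma>] couplingD[OF \<gamma>'])
  then obtain G where "G \<in> couplings \<gamma> \<gamma>'" "AE (p, q) in G. label (snd p) = label (fst q)"
    using coupling_with_same_label[OF couplingD(1)[OF \<gamma>] couplingD(1)[OF \<gamma>']
      measurable_compose[OF couplingD(4)[OF \<gamma>] label] measurable_compose[OF couplingD(3)[OF \<gamma>'] label]]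
    by blast
  then show ?thesis
    using close by (intro bexI[of _ G]) (auto simp: split_beta)
qed

section \<open>The Huber cost as an infimal convolution\<close>

lemma huber_cost_min_form:
  "huber_cost lam x y = (min lam (dist x y))\<^sup>2 / 2 + lam * (dist x y - min lam (dist x y))"
  by (simp add: huber_cost_def min_def power2_eq_square algebra_simps)

lemma continuous_huber_cost: "continuous_on S (\<lambda>(x, y). huber_cost lam x y)"
  unfolding huber_cost_min_form split_beta by (intro continuous_intros) simp

lemma huber_cost_nonneg: "0 \<le> lam \<Longrightarrow> 0 \<le> huber_cost lam x y"
  unfolding huber_cost_min_form by (intro add_nonneg_nonneg mult_nonneg_nonneg) auto

text \<open>
  As a function of the distance \<open>d\<close>, the Huber cost lies below \<open>a\<^sup>2 / 2 + lam * (d - a)\<close> for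
  \<open>a \<le> d\<close>: the difference is \<open>(a - lam)\<^sup>2 / 2\<close> when \<open>d > lam\<close>, whatever \<open>a\<close> is, and at least
  \<open>(d - a)\<^sup>2 / 2\<close> when \<open>d \<le> lam\<close>. If \<open>d \<le> lam\<close> and \<open>a \<ge> d\<close>, the first
  leg alone costs at least \<open>d\<^sup>2 / 2\<close>.
\<close>

lemma huber_cost_le_detour:
  assumes "0 \<le> lam"
  shows "huber_cost lam x y \<le> 1 / 2 * (dist x z)\<^sup>2 + lam * dist z y"
proof -
  define a d where "a = dist x z" and "d = dist x y"
  have "d - a \<le> dist z y" using dist_triangle[of x y z] by (simp add: a_def d_def)
  then have b: "lam * (d - a) \<le> lam * dist z y" "0 \<le> lam * dist z y"
    using assms by (auto intro: mult_left_mono)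
  have "0 \<le> a" "0 \<le> d" by (auto simp: a_def d_def)
  consider "lam < d" | "d \<le> lam" "d \<le> a" | "d \<le> lam" "a < d" by linarith
  then have "(if d \<le> lam then 1 / 2 * d\<^sup>2 else lam * d - lam\<^sup>2 / 2) \<le> 1 / 2 * a\<^sup>2 + lam * dist z y"
  proof cases
    case 1
    have "0 \<le> (a - lam)\<^sup>2" by simp
    then show ?thesis using 1 b by (simp add: power2_eq_square algebra_simps)
  next
    case 2
    then have "d\<^sup>2 \<le> a\<^sup>2" using \<open>0 \<le> d\<close> by (intro power_mono)
    then show ?thesis using 2 b by simp
  next
    case 3
    then have "d * (d - a) \<le> lam * (d - a)" by (intro mult_right_mono) auto
    moreover have "0 \<le> (d - a)\<^sup>2" by simp
    ultimately show ?thesis using 3 b by (simp add: power2_eq_square algebra_simps)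
  qed
  then show ?thesis unfolding huber_cost_def a_def d_def .
qed

text \<open>
  The point of the segment from \<open>x\<close> to \<open>y\<close> at distance \<open>min lam (dist x y)\<close> from \<open>x\<close>; writing the
  factor with \<open>max\<close> avoids a division by zero at \<open>x = y\<close> and makes continuity visible.
\<close>

definition huber_split :: "real \<Rightarrow> 'a::real_normed_vector \<Rightarrow> 'a \<Rightarrow> 'a" where
  "huber_split lam x y = x + (lam / max lam (dist x y)) *\<^sub>R (y - x)"

lemma continuous_huber_split:
  assumes "0 < lam"
  shows "continuous_on S (\<lambda>w. huber_split lam (fst w) (snd w))"
  unfolding huber_split_def using assms by (intro continuous_intros) (auto simp: max_def)

lemma huber_split_in_convex:
  assumes "convex \<Omega>" and "x \<in> \<Omega>" and "y \<in> \<Omega>" and "0 < lam"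
  shows "huber_split lam x y \<in> \<Omega>"
proof -
  define t where "t = lam / max lam (dist x y)"
  have "0 \<le> t" "t \<le> 1" using assms(4) by (auto simp: t_def divide_simps max_def)
  then have "(1 - t) *\<^sub>R x + t *\<^sub>R y \<in> \<Omega>"
    using assms by (intro convexD_alt) auto
  then show ?thesis by (simp add: huber_split_def t_def[symmetric] algebra_simps)
qed

lemma huber_cost_eq_split:
  assumes "0 < lam"
  shows "huber_cost lam x y
    = 1 / 2 * (dist x (huber_split lam x y))\<^sup>2 + lam * dist (huber_split lam x y) y"
proof -
  define t where "t = lam / max lam (dist x y)"
  have t: "0 \<le> t" "t \<le> 1" using assms by (auto simp: t_def divide_simps max_def)
  have from_x: "dist x (huber_split lam x y) = t * dist x y"
  proof -
    have "huber_split lam x y - x = t *\<^sub>R (y - x)"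
      by (simp add: huber_split_def t_def[symmetric])
    then have "norm (huber_split lam x y - x) = t * norm (y - x)"
      using t by simp
    then show ?thesis by (simp add: dist_norm norm_minus_commute)
  qed
  have moved: "t * dist x y = min lam (dist x y)"
    using assms by (auto simp: t_def max_def min_def)
  have to_y: "dist (huber_split lam x y) y = dist x y - t * dist x y"
  proof -
    have "huber_split lam x y - y = (1 - t) *\<^sub>R (x - y)"
      by (simp add: huber_split_def t_def[symmetric] algebra_simps)
    then show ?thesis using t by (simp add: dist_norm left_diff_distrib)
  qed
  show ?thesis
    unfolding huber_cost_min_form from_x to_y moved by simp
qed

section \<open>Comparison of the two variational problems\<close>

lemma prob_measures_onD:
  assumes "\<mu> \<in> prob_measures_on \<Omega>"
  shows "prob_space \<mu>" "sets \<mu> = sets (restrict_space borel \<Omega>)" "space \<mu> = \<Omega>"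
    "(\<lambda>x. x) \<in> \<mu> \<rightarrow>\<^sub>M borel"
proof -
  show s: "sets \<mu> = sets (restrict_space borel \<Omega>)"
    using assms by (simp add: prob_measures_on_def)
  show "space \<mu> = \<Omega>"
    using sets_eq_imp_space_eq[OF s] by (simp add: space_restrict_space)
  show "(\<lambda>x. x) \<in> \<mu> \<rightarrow>\<^sub>M borel"
    by (simp add: measurable_cong_sets[OF s refl] measurable_restrict_space1)
qed (use assms in \<open>simp add: prob_measures_on_def\<close>)

text \<open>
  Glue two plans through \<open>\<rho>\<close> approximately and forget the two intermediate points
  \<open>z\<close>, \<open>z'\<close>. The detour inequality through \<open>z\<close> bounds the Huber cost by the two given costs plus
  \<open>lam * dist z z'\<close>. Only the cost of linear growth is affected by the gap, so the error is uniform.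
\<close>

lemma huber_transport_cost_le:
  fixes \<Omega> :: "'a::{second_countable_topology, metric_space} set"
  assumes "compact \<Omega>" and "0 \<le> lam"
    and \<mu>: "\<mu> \<in> prob_measures_on \<Omega>" and \<rho>: "\<rho> \<in> prob_measures_on \<Omega>" and \<nu>: "\<nu> \<in> prob_measures_on \<Omega>"
  shows "transport_cost (huber_cost lam) \<mu> \<nu>
    \<le> 1 / 2 * transport_cost (\<lambda>x y. (dist x y)\<^sup>2) \<mu> \<rho> + lam * transport_cost dist \<rho> \<nu>"
    (is "?H \<le> 1 / 2 * ?C2 + lam * ?C1")
proof -
  have eps: "?H \<le> 1 / 2 * (\<integral>(x, z). (dist x z)\<^sup>2 \<partial>\<gamma>) + lam * (\<integral>(z, y). dist z y \<partial>\<gamma>') + lam * \<epsilon>"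
    if \<gamma>: "\<gamma> \<in> couplings \<mu> \<rho>" and \<gamma>': "\<gamma>' \<in> couplings \<rho> \<nu>" and "0 < \<epsilon>" for \<gamma> \<gamma>' \<epsilon>
  proof -
    obtain G where G: "G \<in> couplings \<gamma> \<gamma>'" and close: "AE (p, q) in G. dist (snd p) (fst q) < \<epsilon>"
      using approximate_gluing[OF \<gamma> \<gamma>' prob_measures_onD(4)[OF \<rho>] \<open>0 < \<epsilon>\<close>] by blast
    interpret G: prob_space G by (rule couplingD(1)[OF G])
    have p: "fst \<in> G \<rightarrow>\<^sub>M \<gamma>" and q: "snd \<in> G \<rightarrow>\<^sub>M \<gamma>'" by (rule couplingD[OF G])+
    have x: "(\<lambda>w. fst (fst w)) \<in> G \<rightarrow>\<^sub>M \<mu>" and y: "(\<lambda>w. snd (snd w)) \<in> G \<rightarrow>\<^sub>M \<nu>"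
      using measurable_compose[OF p couplingD(3)[OF \<gamma>]] measurable_compose[OF q couplingD(4)[OF \<gamma>']]
      by auto
    have xy: "(\<lambda>w. (fst (fst w), snd (snd w))) \<in> G \<rightarrow>\<^sub>M \<mu> \<Otimes>\<^sub>M \<nu>"
      using x y by (rule measurable_Pair)
    define \<eta> where "\<eta> = distr G (\<mu> \<Otimes>\<^sub>M \<nu>) (\<lambda>w. (fst (fst w), snd (snd w)))"
    have "distr G \<mu> (\<lambda>w. fst (fst w)) = \<mu>"
      using distr_distr[OF couplingD(3)[OF \<gamma>] p]
      by (simp add: o_def couplingD(5)[OF G] couplingD(5)[OF \<gamma>])
    moreover have "distr G \<nu> (\<lambda>w. snd (snd w)) = \<nu>"
      using distr_distr[OF couplingD(4)[OF \<gamma>'] q]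
      by (simp add: o_def couplingD(6)[OF G] couplingD(6)[OF \<gamma>'])
    ultimately have \<eta>: "\<eta> \<in> couplings \<mu> \<nu>"
      unfolding \<eta>_def by (intro distr_Pair_in_couplings x y G.prob_space_axioms)
    have int_h: "integrable \<eta> (\<lambda>(x, y). huber_cost lam x y)"
      by (rule integrable_coupling[OF assms(1) \<mu> \<nu> \<eta> continuous_huber_cost])
    have int2: "integrable \<gamma> (\<lambda>(x, z). (dist x z)\<^sup>2)"
      by (rule integrable_coupling[OF assms(1) \<mu> \<rho> \<gamma>]) (auto simp: split_beta intro!: continuous_intros)
    have int1: "integrable \<gamma>' (\<lambda>(z, y). dist z y)"
      by (rule integrable_coupling[OF assms(1) \<rho> \<nu> \<gamma>']) (auto simp: split_beta intro!: continuous_intros)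
    have int2': "integrable G (\<lambda>w. (dist (fst (fst w)) (snd (fst w)))\<^sup>2)"
      using int2 integrable_distr[OF p, of "\<lambda>(x, z). (dist x z)\<^sup>2"] couplingD(5)[OF G]
      by (simp add: split_beta)
    have int1': "integrable G (\<lambda>w. dist (fst (snd w)) (snd (snd w)))"
      using int1 integrable_distr[OF q, of "\<lambda>(z, y). dist z y"] couplingD(6)[OF G]
      by (simp add: split_beta)
    have "?H \<le> (\<integral>(x, y). huber_cost lam x y \<partial>\<eta>)"
      by (rule transport_cost_le_integral[OF huber_cost_nonneg[OF assms(2)] \<eta>])
    also have "\<dots> = (\<integral>w. huber_cost lam (fst (fst w)) (snd (snd w)) \<partial>G)"
      using integral_distr[OF xy, of "\<lambda>(x, y). huber_cost lam x y"] int_h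
        borel_measurable_integrable[OF int_h]
      by (simp add: \<eta>_def split_beta)
    also have "\<dots> \<le> (\<integral>w. 1 / 2 * (dist (fst (fst w)) (snd (fst w)))\<^sup>2
        + lam * dist (fst (snd w)) (snd (snd w)) + lam * \<epsilon> \<partial>G)"
    proof (rule integral_mono_AE)
      show "integrable G (\<lambda>w. huber_cost lam (fst (fst w)) (snd (snd w)))"
        using int_h integrable_distr[OF xy, of "\<lambda>(x, y). huber_cost lam x y"]
        by (simp add: \<eta>_def split_beta)
      show "integrable G (\<lambda>w. 1 / 2 * (dist (fst (fst w)) (snd (fst w)))\<^sup>2
          + lam * dist (fst (snd w)) (snd (snd w)) + lam * \<epsilon>)"
        using int2' int1' by (intro Bochner_Integration.integrable_add integrable_mult_right G.integrable_const)
      have "AE w in G. dist (snd (fst w)) (fst (snd w)) < \<epsilon>"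
        using close by (simp add: split_beta)
      then show "AE w in G. huber_cost lam (fst (fst w)) (snd (snd w))
          \<le> 1 / 2 * (dist (fst (fst w)) (snd (fst w)))\<^sup>2
            + lam * dist (fst (snd w)) (snd (snd w)) + lam * \<epsilon>"
      proof eventually_elim
        case (elim w)
        have "dist (snd (fst w)) (snd (snd w)) \<le> dist (fst (snd w)) (snd (snd w)) + \<epsilon>"
          using elim dist_triangle[of "snd (fst w)" "snd (snd w)" "fst (snd w)"] by linarith
        then have "lam * dist (snd (fst w)) (snd (snd w)) \<le> lam * (dist (fst (snd w)) (snd (snd w)) + \<epsilon>)"
          using assms(2) by (rule mult_left_mono)
        then show ?case
          using huber_cost_le_detour[OF assms(2), of "fst (fst w)" "snd (snd w)" "snd (fst w)"]
          by (simp add: algebra_simps)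
      qed
    qed
    also have "\<dots> = 1 / 2 * (\<integral>w. (dist (fst (fst w)) (snd (fst w)))\<^sup>2 \<partial>G)
        + lam * (\<integral>w. dist (fst (snd w)) (snd (snd w)) \<partial>G) + lam * \<epsilon>"
      using int2' int1' by (simp add: G.prob_space)
    also have "(\<integral>w. (dist (fst (fst w)) (snd (fst w)))\<^sup>2 \<partial>G) = (\<integral>(x, z). (dist x z)\<^sup>2 \<partial>\<gamma>)"
      using integral_distr[OF p borel_measurable_integrable[OF int2]] couplingD(5)[OF G]
      by (simp add: split_beta)
    also have "(\<integral>w. dist (fst (snd w)) (snd (snd w)) \<partial>G) = (\<integral>(z, y). dist z y \<partial>\<gamma>')"
      using integral_distr[OF q borel_measurable_integrable[OF int1]] couplingD(6)[OF G]
      by (simp add: split_beta)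
    finally show ?thesis .
  qed
  have plans: "?H \<le> 1 / 2 * (\<integral>(x, z). (dist x z)\<^sup>2 \<partial>\<gamma>) + lam * (\<integral>(z, y). dist z y \<partial>\<gamma>')"
    if "\<gamma> \<in> couplings \<mu> \<rho>" and "\<gamma>' \<in> couplings \<rho> \<nu>" for \<gamma> \<gamma>'
  proof (rule field_le_epsilon)
    fix e :: real assume "0 < e"
    \<comment> \<open>Dividing by \<open>lam + 1\<close> covers the degenerate slope \<open>lam = 0\<close>.\<close>
    then have "0 < e / (lam + 1)" and "lam * (e / (lam + 1)) \<le> e"
      using assms(2) by (auto simp: field_simps)
    then show "?H \<le> 1 / 2 * (\<integral>(x, z). (dist x z)\<^sup>2 \<partial>\<gamma>) + lam * (\<integral>(z, y). dist z y \<partial>\<gamma>') + e"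
      using eps[OF that, of "e / (lam + 1)"] by linarith
  qed
  have "?H \<le> 1 / 2 * ?C2 + lam * (\<integral>(z, y). dist z y \<partial>\<gamma>')" if "\<gamma>' \<in> couplings \<rho> \<nu>" for \<gamma>'
  proof -
    have "2 * (?H - lam * (\<integral>(z, y). dist z y \<partial>\<gamma>')) \<le> ?C2"
      using plans[OF _ that]
      by (intro transport_cost_greatest prob_measures_onD(1)[OF \<mu>] prob_measures_onD(1)[OF \<rho>]) fastforce
    then show ?thesis by simp
  qed
  then have first: "?H - 1 / 2 * ?C2 \<le> lam * (\<integral>(z, y). dist z y \<partial>\<gamma>')" if "\<gamma>' \<in> couplings \<rho> \<nu>" for \<gamma>'
    using that by fastforce
  have "?H - 1 / 2 * ?C2 \<le> lam * ?C1"
  proof (cases "lam = 0")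
    case True
    then show ?thesis
      using first[OF pair_measure_in_couplings] prob_measures_onD(1)[OF \<rho>] prob_measures_onD(1)[OF \<nu>] by simp
  next
    case False
    then have "0 < lam" using assms(2) by simp
    then have "(?H - 1 / 2 * ?C2) / lam \<le> ?C1"
      using first
      by (intro transport_cost_greatest prob_measures_onD(1)[OF \<rho>] prob_measures_onD(1)[OF \<nu>])
        (simp add: pos_divide_le_eq mult.commute)
    then show ?thesis using \<open>0 < lam\<close> by (simp add: pos_divide_le_eq mult.commute)
  qed
  then show ?thesis by simp
qed

text \<open>
  \<open>\<rho>\<close> is the law of the point at which the Huber cost of \<open>(x, y)\<close> splits into its two parts; it is
  carried by \<open>\<Omega>\<close> because \<open>\<Omega>\<close> is convex.
\<close>

lemma exists_intermediate_measure_of_plan: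
  fixes \<Omega> :: "'a::{second_countable_topology, real_normed_vector} set"
  assumes "compact \<Omega>" and "convex \<Omega>" and "0 < lam"
    and \<mu>: "\<mu> \<in> prob_measures_on \<Omega>" and \<nu>: "\<nu> \<in> prob_measures_on \<Omega>"
    and \<gamma>: "\<gamma> \<in> couplings \<mu> \<nu>"
  shows "\<exists>\<rho>\<in>prob_measures_on \<Omega>. 1 / 2 * transport_cost (\<lambda>x y. (dist x y)\<^sup>2) \<mu> \<rho>
    + lam * transport_cost dist \<rho> \<nu> \<le> (\<integral>(x, y). huber_cost lam x y \<partial>\<gamma>)"
proof -
  interpret \<gamma>: prob_space \<gamma> by (rule couplingD(1)[OF \<gamma>])
  have x: "fst \<in> \<gamma> \<rightarrow>\<^sub>M \<mu>" and y: "snd \<in> \<gamma> \<rightarrow>\<^sub>M \<nu>" by (rule couplingD[OF \<gamma>])+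
  define z where "z w = huber_split lam (fst w) (snd w)" for w :: "'a \<times> 'a"
  define \<rho> where "\<rho> = distr \<gamma> (restrict_space borel \<Omega>) z"
  have pair: "(\<lambda>w. (fst w, snd w)) \<in> \<gamma> \<rightarrow>\<^sub>M borel \<Otimes>\<^sub>M borel"
    using measurable_compose[OF x prob_measures_onD(4)[OF \<mu>]]
      measurable_compose[OF y prob_measures_onD(4)[OF \<nu>]]
    by (rule measurable_Pair)
  have "z \<in> borel_measurable borel"
    unfolding z_def by (rule borel_measurable_continuous_onI[OF continuous_huber_split[OF assms(3)]])
  from measurable_compose[OF pair[unfolded borel_prod] this]
  have "z \<in> borel_measurable \<gamma>" by simp
  moreover have "z w \<in> \<Omega>" if "w \<in> space \<gamma>" for w
    using measurable_space[OF x that] measurable_space[OF y that]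
    by (auto simp: z_def prob_measures_onD(3)[OF \<mu>] prob_measures_onD(3)[OF \<nu>]
        intro!: huber_split_in_convex assms(2,3))
  ultimately have z_restr: "z \<in> \<gamma> \<rightarrow>\<^sub>M restrict_space borel \<Omega>"
    by (intro measurable_restrict_space2) auto
  have \<rho>: "\<rho> \<in> prob_measures_on \<Omega>"
    unfolding prob_measures_on_def \<rho>_def using \<gamma>.prob_space_distr[OF z_restr] by simp
  have sets_\<rho>: "sets \<rho> = sets (restrict_space borel \<Omega>)" by (simp add: \<rho>_def)
  have z: "z \<in> \<gamma> \<rightarrow>\<^sub>M \<rho>" using z_restr by (simp add: measurable_cong_sets[OF refl sets_\<rho>])
  have z_law: "distr \<gamma> \<rho> z = \<rho>"
    unfolding \<rho>_def by (rule distr_cong) auto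
  define \<gamma>\<^sub>1 where "\<gamma>\<^sub>1 = distr \<gamma> (\<mu> \<Otimes>\<^sub>M \<rho>) (\<lambda>w. (fst w, z w))"
  define \<gamma>\<^sub>2 where "\<gamma>\<^sub>2 = distr \<gamma> (\<rho> \<Otimes>\<^sub>M \<nu>) (\<lambda>w. (z w, snd w))"
  have \<gamma>1: "\<gamma>\<^sub>1 \<in> couplings \<mu> \<rho>"
    unfolding \<gamma>\<^sub>1_def
    by (intro distr_Pair_in_couplings \<gamma>.prob_space_axioms x z couplingD(5)[OF \<gamma>] z_law)
  have \<gamma>2: "\<gamma>\<^sub>2 \<in> couplings \<rho> \<nu>"
    unfolding \<gamma>\<^sub>2_def
    by (intro distr_Pair_in_couplings \<gamma>.prob_space_axioms y z couplingD(6)[OF \<gamma>] z_law)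
  have int2: "integrable \<gamma>\<^sub>1 (\<lambda>(x, z). (dist x z)\<^sup>2)"
    by (rule integrable_coupling[OF assms(1) \<mu> \<rho> \<gamma>1]) (auto simp: split_beta intro!: continuous_intros)
  have int1: "integrable \<gamma>\<^sub>2 (\<lambda>(z, y). dist z y)"
    by (rule integrable_coupling[OF assms(1) \<rho> \<nu> \<gamma>2]) (auto simp: split_beta intro!: continuous_intros)
  have xz: "(\<lambda>w. (fst w, z w)) \<in> \<gamma> \<rightarrow>\<^sub>M \<mu> \<Otimes>\<^sub>M \<rho>" and zy: "(\<lambda>w. (z w, snd w)) \<in> \<gamma> \<rightarrow>\<^sub>M \<rho> \<Otimes>\<^sub>M \<nu>"
    using x y z by (auto intro: measurable_Pair)
  have int2': "integrable \<gamma> (\<lambda>w. (dist (fst w) (z w))\<^sup>2)"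
    using integrable_distr[OF xz int2[unfolded \<gamma>\<^sub>1_def]] by simp
  have int1': "integrable \<gamma> (\<lambda>w. dist (z w) (snd w))"
    using integrable_distr[OF zy int1[unfolded \<gamma>\<^sub>2_def]] by simp
  have "transport_cost (\<lambda>x y. (dist x y)\<^sup>2) \<mu> \<rho> \<le> (\<integral>(x, z). (dist x z)\<^sup>2 \<partial>\<gamma>\<^sub>1)"
    by (rule transport_cost_le_integral[OF _ \<gamma>1]) simp
  also have "\<dots> = (\<integral>w. (dist (fst w) (z w))\<^sup>2 \<partial>\<gamma>)"
    using integral_distr[OF xz, of "\<lambda>(x, z). (dist x z)\<^sup>2"] borel_measurable_integrable[OF int2] by (simp add: \<gamma>\<^sub>1_def split_beta)
  finally have C2: "transport_cost (\<lambda>x y. (dist x y)\<^sup>2) \<mu> \<rho> \<le> \<dots>" .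
  have "transport_cost dist \<rho> \<nu> \<le> (\<integral>(z, y). dist z y \<partial>\<gamma>\<^sub>2)"
    by (rule transport_cost_le_integral[OF _ \<gamma>2]) simp
  also have "\<dots> = (\<integral>w. dist (z w) (snd w) \<partial>\<gamma>)"
    using integral_distr[OF zy, of "\<lambda>(z, y). dist z y"] borel_measurable_integrable[OF int1] by (simp add: \<gamma>\<^sub>2_def split_beta)
  finally have C1: "lam * transport_cost dist \<rho> \<nu> \<le> lam * \<dots>"
    using assms(3) by simp
  have "(\<integral>(x, y). huber_cost lam x y \<partial>\<gamma>)
      = (\<integral>w. 1 / 2 * (dist (fst w) (z w))\<^sup>2 + lam * dist (z w) (snd w) \<partial>\<gamma>)"
    unfolding split_beta z_def huber_cost_eq_split[OF assms(3)] ..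
  also have "\<dots> = 1 / 2 * (\<integral>w. (dist (fst w) (z w))\<^sup>2 \<partial>\<gamma>) + lam * (\<integral>w. dist (z w) (snd w) \<partial>\<gamma>)"
    using int1' int2' by simp
  finally show ?thesis
    using C1 C2 \<rho> by (intro bexI[of _ \<rho>]) auto
qed

theorem corollary5p8:
  fixes \<Omega> :: "(real ^ 'd) set" and \<mu> \<nu> :: "(real ^ 'd) measure" and lam :: real
  assumes "compact \<Omega>" and "convex \<Omega>" and "emeasure lborel (interior \<Omega>) > 0"
    and "\<mu> \<in> prob_measures_on \<Omega>" and "\<nu> \<in> prob_measures_on \<Omega>"
    and "absolutely_continuous (restrict_space lborel \<Omega>) \<mu>"
    and "lam > 0"
  shows "(INF \<rho>\<in>prob_measures_on \<Omega>. 1 / 2 * (wasserstein 2 \<mu> \<rho>)\<^sup>2 + lam * wasserstein 1 \<rho> \<nu>)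
         = transport_cost (huber_cost lam) \<mu> \<nu>"
proof -
  let ?F = "\<lambda>\<rho>. 1 / 2 * (wasserstein 2 \<mu> \<rho>)\<^sup>2 + lam * wasserstein 1 \<rho> \<nu>"
  have p: "prob_space \<mu>" "prob_space \<nu>"
    using assms(4,5) by (auto dest: prob_measures_onD)
  have F: "?F \<rho> = 1 / 2 * transport_cost (\<lambda>x y. (dist x y)\<^sup>2) \<mu> \<rho> + lam * transport_cost dist \<rho> \<nu>"
    if "\<rho> \<in> prob_measures_on \<Omega>" for \<rho>
    using p prob_measures_onD(1)[OF that] by (simp add: wasserstein_1_eq wasserstein_2_squared_eq)
  have lower: "transport_cost (huber_cost lam) \<mu> \<nu> \<le> ?F \<rho>" if "\<rho> \<in> prob_measures_on \<Omega>" for \<rho>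
    unfolding F[OF that]
    using assms(7) by (intro huber_transport_cost_le[OF assms(1) _ assms(4) that assms(5)]) simp
  show ?thesis
  proof (rule antisym)
    show "(INF \<rho>\<in>prob_measures_on \<Omega>. ?F \<rho>) \<le> transport_cost (huber_cost lam) \<mu> \<nu>"
    proof (rule transport_cost_greatest[OF p])
      fix \<gamma> assume "\<gamma> \<in> couplings \<mu> \<nu>"
      then obtain \<rho> where "\<rho> \<in> prob_measures_on \<Omega>" and "?F \<rho> \<le> (\<integral>(x, y). huber_cost lam x y \<partial>\<gamma>)"
        using exists_intermediate_measure_of_plan[OF assms(1,2,7,4,5)] F by metis
      then show "(INF \<rho>\<in>prob_measures_on \<Omega>. ?F \<rho>) \<le> (\<integral>(x, y). huber_cost lam x y \<partial>\<gamma>)"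
        using lower by (intro cINF_lower2 bdd_belowI2) auto
    qed
    show "transport_cost (huber_cost lam) \<mu> \<nu> \<le> (INF \<rho>\<in>prob_measures_on \<Omega>. ?F \<rho>)"
      using assms(4) lower by (intro cINF_greatest) auto
  qed
qed

end
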